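(* Let $R=\mathbb{Z}/n\mathbb{Z}$, let $r\in R^\times$ and $a,b\in R$ with $a-b$ not a unit of $R$, and let $f(t)=r\left(\frac{1-at}{1-bt}\right)\in R[[t]]$. Then either $\mu_f$ has finite order (and hence $\mathbb{G}(\mathcal{A}_f)$ is finite), or the torsion subgroup of $\mathbb{G}(\mathcal{A}_f)$, that is, the subgroup $\langle\alpha_{\tilde s(-ar+bf)f^m}: m\in\mathbb{Z},\ \tilde s\in R\rangle$, is annihilated by some integer $s$ with $0<s<n$ and hence is not isomorphic to $\bigoplus_{\mathbb{Z}}R^+$. Consequently, $\mathbb{G}(\mathcal{A}_f)$ is not isomorphic to $R^+\wr\mathbb{Z}$.
   Context: $n$ is a positive integer; $R^\times$ is the group of units of $R$, $R^+$ its additive group, and $R[[t]]$ the ring of formal power series over $R$; elements of $R$ are viewed as constant power series, and $\frac{1}{1-bt}=\sum_{k\ge 0}b^kt^k$. The power series $f$ is a unit of $R[[t]]$, so $f^m$ makes sense for all $m\in\mathbb{Z}$. For $h\in R[[t]]$ define maps $R[[t]]\to R[[t]]$ by $\mu_h(g)=hg$ and $\alpha_h(g)=h+g$. Products of maps denote composition. The automaton $\mathcal{A}_f$ is the Mealy automaton with alphabet $R$, state set $Q=\{\alpha_{-sra}\mu_f\alpha_{sb}: s\in R\}$ (a set of permutations of $R[[t]]$), transition function $\delta(\alpha_{-sra}\mu_f\alpha_{sb},\tilde s)=\alpha_{-(sb+\tilde s)ra}\mu_f\alpha_{(sb+\tilde s)b}$ and output function $\lambda(\alpha_{-sra}\mu_f\alpha_{sb},\tilde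 s)=r(\tilde s+(b-a)s)$. Identifying infinite words over $R$ with power series via $(r_0,r_1,\ldots)\mapsto r_0+r_1t+\cdots$, the map computed by this automaton from state $q\in Q$ is $q$ itself, so the automaton group $\mathbb{G}(\mathcal{A}_f)$ is the group of permutations of $R[[t]]$ generated by $\{\alpha_{-sra}\mu_f\alpha_{sb}: s\in R\}$ under composition. $R^+\wr\mathbb{Z}$ denotes the restricted wreath product $\left(\bigoplus_{\mathbb{Z}}R^+\right)\rtimes\mathbb{Z}$. An abelian group (written additively) is annihilated by $s$ if $s$ times each of its elements is zero. *)

theory Defs
  imports
    "HOL-Algebra.Algebra"
    "HOL-Computational_Algebra.Formal_Power_Series"
    "Berlekamp_Zassenhaus.Finite_Field"
begin

text \<open>The ring \<open>\<int>/n\<int>\<close> is the type \<open>'n mod_ring\<close> with \<open>n = CARD('n)\<close>. The class \<open>nontriv\<close>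
  needed for its unit element excludes \<open>n = 1\<close>; there every element, including \<open>0\<close>, is a unit,
  so no non-unit \<open>a - b\<close> exists. Units of a commutative ring are the divisors of \<open>1\<close>; the library's
  \<open>is_unit\<close> abbreviation is confined to integral domains.\<close>

unbundle fps_syntax

section \<open>Mealy automata and automaton groups\<close>

text \<open>The alphabet is the type of letters.\<close>

record ('q, 'x) mealy =
  mealy_states :: "'q set"
  mealy_next :: "'q \<Rightarrow> 'x \<Rightarrow> 'q"
  mealy_out :: "'q \<Rightarrow> 'x \<Rightarrow> 'x"

fun mealy_map :: "('q, 'x) mealy \<Rightarrow> 'q \<Rightarrow> (nat \<Rightarrow> 'x) \<Rightarrow> nat \<Rightarrow> 'x" where
  "mealy_map A q w 0 = mealy_out A q (w 0)"
| "mealy_map A q w (Suc k) = mealy_map A (mealy_next A q (w 0)) (\<lambda>i. w (Suc i)) k"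

text \<open>An infinite word \<open>w\<close> is identified with the power series \<open>Abs_fps w\<close>.\<close>

definition mealy_action :: "('q, 'x) mealy \<Rightarrow> 'q \<Rightarrow> 'x fps \<Rightarrow> 'x fps" where
  "mealy_action A q g = Abs_fps (mealy_map A q (fps_nth g))"

abbreviation fps_perms :: "('x fps \<Rightarrow> 'x fps) monoid" where
  "fps_perms \<equiv> BijGroup UNIV"

text \<open>\<open>subgroup_generated\<close> discards generators outside the carrier; for the automata
  below nothing is discarded, see \<open>Af_action_in_perms\<close>.\<close>

definition automaton_group :: "('q, 'x) mealy \<Rightarrow> ('x fps \<Rightarrow> 'x fps) monoid" where
  "automaton_group A = subgroup_generated fps_perms (mealy_action A ` mealy_states A)"


section \<open>The automaton attached to a Moebius power series\<close>

definition fps_mu :: "'a::comm_ring_1 fps \<Rightarrow> 'a fps \<Rightarrow> 'a fps" where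
  "fps_mu h g = h * g"

definition fps_alpha :: "'a::comm_ring_1 fps \<Rightarrow> 'a fps \<Rightarrow> 'a fps" where
  "fps_alpha h g = h + g"

text \<open>The series \<open>1 / (1 - b t)\<close>. Division on \<open>fps\<close> needs an inverse operation on the
  coefficients, which a ring such as \<open>\<int>/n\<int>\<close> does not have.\<close>

definition fps_geom :: "'a::comm_ring_1 \<Rightarrow> 'a fps" where
  "fps_geom b = Abs_fps (\<lambda>k. b ^ k)"

definition moebius_fps :: "'a::comm_ring_1 \<Rightarrow> 'a \<Rightarrow> 'a \<Rightarrow> 'a fps" where
  "moebius_fps r a b = fps_const r * ((1 - fps_const a * fps_X) * fps_geom b)"

definition unit_powi :: "'a::comm_ring_1 \<Rightarrow> int \<Rightarrow> 'a" where
  "unit_powi u m = (if 0 \<le> m then u ^ nat m else (THE v. u * v = 1) ^ nat (- m))"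

definition Af_state :: "'a::comm_ring_1 \<Rightarrow> 'a \<Rightarrow> 'a \<Rightarrow> 'a \<Rightarrow> 'a fps \<Rightarrow> 'a fps" where
  "Af_state r a b s =
     fps_alpha (fps_const (- (s * r * a))) \<circ> fps_mu (moebius_fps r a b) \<circ> fps_alpha (fps_const (s * b))"

text \<open>The states are the permutations themselves, and different \<open>s\<close> can give the same state.
  The transition and output functions do not depend on the choice of \<open>s\<close>; see
  \<open>Af_next_state\<close> and \<open>Af_out_state\<close>.\<close>

definition Af :: "'a::comm_ring_1 \<Rightarrow> 'a \<Rightarrow> 'a \<Rightarrow> ('a fps \<Rightarrow> 'a fps, 'a) mealy" where
  "Af r a b =
     \<lparr>mealy_states = range (Af_state r a b),
      mealy_next = (\<lambda>q x. THE q'. \<exists>s. q = Af_state r a b s \<and> q' = Af_state r a b (s * b + x)),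
      mealy_out = (\<lambda>q x. THE y. \<exists>s. q = Af_state r a b s \<and> y = r * (x + (b - a) * s))\<rparr>"

lemma one_minus_X_geom: "(1 - fps_const b * fps_X) * fps_geom b = 1"
proof (rule fps_ext)
  fix n
  show "((1 - fps_const b * fps_X) * fps_geom b) $ n = 1 $ n"
    by (cases n) (simp_all add: fps_geom_def left_diff_distrib mult.assoc)
qed

lemma moebius_diff:
  "fps_const b * moebius_fps r a b - fps_const (r * a) = fps_const (r * (b - a)) * fps_geom b"
proof -
  have eq: "fps_const (r * a) = fps_const (r * a) * ((1 - fps_const b * fps_X) * fps_geom b)"
    by (simp add: one_minus_X_geom)
  show ?thesis
    unfolding moebius_fps_def
    by (subst eq) (simp add: algebra_simps flip: fps_const_mult fps_const_add fps_const_sub fps_const_neg)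
qed

lemma Af_state_eq:
  "Af_state r a b s g = moebius_fps r a b * g + fps_const (s * (r * (b - a))) * fps_geom b"
proof -
  have "Af_state r a b s g = moebius_fps r a b * g
      + fps_const s * (fps_const b * moebius_fps r a b - fps_const (r * a))"
    unfolding Af_state_def fps_alpha_def fps_mu_def o_def
    by (simp add: algebra_simps flip: fps_const_mult fps_const_add fps_const_sub fps_const_neg)
  then show ?thesis
    unfolding moebius_diff by (simp add: mult.assoc flip: fps_const_mult)
qed

lemma Af_state_cong:
  assumes "Af_state r a b s = Af_state r a b s'"
  shows "s * (r * (b - a)) = s' * (r * (b - a))"
proof -
  have "Af_state r a b s 0 $ 0 = Af_state r a b s' 0 $ 0"
    by (simp add: assms)
  then show ?thesis
    by (simp add: Af_state_eq fps_geom_def)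
qed

lemma Af_next_state: "mealy_next (Af r a b) (Af_state r a b s) x = Af_state r a b (s * b + x)"
proof -
  have "Af_state r a b (s' * b + x) = Af_state r a b (s * b + x)"
    if "Af_state r a b s = Af_state r a b s'" for s'
  proof -
    have "(s' * b + x) * (r * (b - a)) = b * (s' * (r * (b - a))) + x * (r * (b - a))"
      by (simp add: algebra_simps)
    also have "\<dots> = (s * b + x) * (r * (b - a))"
      by (simp add: Af_state_cong[OF that, symmetric]) (simp add: algebra_simps)
    finally show ?thesis
      by (simp add: Af_state_eq fun_eq_iff)
  qed
  then show ?thesis
    unfolding Af_def mealy.simps by (intro the_equality) blast+
qed

lemma Af_out_state: "mealy_out (Af r a b) (Af_state r a b s) x = r * (x + (b - a) * s)"
proof -
  have "r * (x + (b - a) * s') = r * (x + (b - a) * s)"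
    if "Af_state r a b s = Af_state r a b s'" for s'
    using Af_state_cong[OF that] by (simp add: algebra_simps)
  then show ?thesis
    unfolding Af_def mealy.simps by (intro the_equality) blast+
qed

lemma Af_state_rec:
  "Af_state r a b s g = fps_const (r * (g $ 0 + (b - a) * s))
     + fps_X * Af_state r a b (s * b + g $ 0) (fps_shift 1 g)"
proof -
  define c where "c = g $ 0"
  define h where "h = fps_shift 1 g"
  define d where "d = fps_const (r * (b - a)) * fps_geom b"
  have g: "g = fps_const c + fps_X * h"
    unfolding c_def h_def
    by (rule fps_ext) (simp add: fps_X_mult_nth)
  have geom: "fps_geom b = 1 + fps_const b * fps_X * fps_geom b"
  proof -
    have "fps_geom b = (1 - fps_const b * fps_X) * fps_geom b + fps_const b * fps_X * fps_geom b"
      by (simp add: left_diff_distrib)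
    then show ?thesis
      by (simp only: one_minus_X_geom)
  qed
  have d: "d = fps_const (r * (b - a)) + fps_const b * fps_X * d"
    unfolding d_def by (subst geom) (simp add: algebra_simps flip: fps_const_mult fps_const_add fps_const_sub fps_const_neg)
  have "moebius_fps r a b = fps_const r * fps_geom b - fps_const (r * a) * fps_X * fps_geom b"
    unfolding moebius_fps_def by (simp add: algebra_simps flip: fps_const_mult fps_const_add fps_const_sub fps_const_neg)
  also have "\<dots> = fps_const r + fps_const (r * b) * fps_X * fps_geom b
      - fps_const (r * a) * fps_X * fps_geom b"
    by (subst geom) (simp add: algebra_simps flip: fps_const_mult fps_const_add fps_const_sub fps_const_neg)
  also have "\<dots> = fps_const r + fps_X * d"
    unfolding d_def by (simp add: algebra_simps flip: fps_const_mult fps_const_add fps_const_sub fps_const_neg)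
  finally have f: "moebius_fps r a b = fps_const r + fps_X * d" .
  have "Af_state r a b s g = moebius_fps r a b * (fps_const c + fps_X * h) + fps_const s * d"
    unfolding Af_state_eq d_def by (simp add: g mult.assoc flip: fps_const_mult)
  also have "\<dots> = fps_X * (moebius_fps r a b * h) + fps_const c * moebius_fps r a b + fps_const s * d"
    by (simp add: algebra_simps)
  also have "fps_const c * moebius_fps r a b = fps_const (c * r) + fps_X * (fps_const c * d)"
    by (simp add: f algebra_simps flip: fps_const_mult fps_const_add fps_const_sub fps_const_neg)
  also have "fps_const s * d = fps_const (s * (r * (b - a))) + fps_X * (fps_const (s * b) * d)"
    by (subst d) (simp add: algebra_simps flip: fps_const_mult fps_const_add fps_const_sub fps_const_neg)
  finally show ?thesis
    unfolding Af_state_eq c_def[symmetric] h_def[symmetric]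
    by (simp add: d_def algebra_simps flip: fps_const_mult fps_const_add fps_const_sub fps_const_neg)
qed

lemma Af_mealy_map: "mealy_map (Af r a b) (Af_state r a b s) (fps_nth g) k = Af_state r a b s g $ k"
proof (induction k arbitrary: s g)
  case 0
  show ?case
    by (subst Af_state_rec) (simp add: Af_out_state)
next
  case (Suc k)
  have shift: "fps_nth (fps_shift 1 g) = (\<lambda>i. g $ Suc i)"
    by (rule ext) simp
  have "mealy_map (Af r a b) (Af_state r a b s) (fps_nth g) (Suc k)
      = mealy_map (Af r a b) (Af_state r a b (s * b + g $ 0)) (fps_nth (fps_shift 1 g)) k"
    by (simp add: Af_next_state shift del: One_nat_def)
  also have "\<dots> = Af_state r a b (s * b + g $ 0) (fps_shift 1 g) $ k"
    by (rule Suc.IH)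
  also have "\<dots> = Af_state r a b s g $ Suc k"
    by (subst Af_state_rec[of r a b s g]) simp
  finally show ?case .
qed

lemma Af_action: "mealy_action (Af r a b) (Af_state r a b s) = Af_state r a b s"
  by (rule ext, rule fps_ext) (simp add: mealy_action_def Af_mealy_map)

lemma Af_action_in_perms:
  assumes "r dvd 1"
  shows "mealy_action (Af r a b) ` mealy_states (Af r a b) \<subseteq> carrier fps_perms"
proof -
  obtain r' where r': "1 = r * r'"
    using assms by (rule dvdE)
  define h where "h = fps_const r' * ((1 - fps_const b * fps_X) * fps_geom a)"
  have "moebius_fps r a b * h = fps_const (r * r')
      * ((1 - fps_const a * fps_X) * fps_geom a) * ((1 - fps_const b * fps_X) * fps_geom b)"
    unfolding moebius_fps_def h_def by (simp add: mult_ac flip: fps_const_mult)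
  then have unit: "moebius_fps r a b * h = 1"
    by (simp add: one_minus_X_geom r'[symmetric])
  have "bij (Af_state r a b s)" for s
  proof -
    define e where "e = fps_const (s * (r * (b - a))) * fps_geom b"
    have "h * (moebius_fps r a b * g) = g" "moebius_fps r a b * (h * g) = g" for g
      by (simp_all only: mult.assoc[symmetric] mult.commute[of h "moebius_fps r a b"] unit mult_1_left)
    then show ?thesis
      unfolding Af_state_eq[abs_def] e_def[symmetric]
      by (intro bij_betw_byWitness[where f' = "\<lambda>g. h * (g - e)"]) auto
  qed
  then show ?thesis
    by (auto simp: Af_def Af_action[unfolded Af_def] BijGroup_def Bij_def)
qed

lemma automaton_group_Af:
  "automaton_group (Af r a b) = subgroup_generated fps_perms (range (Af_state r a b))"
proof -
  have "mealy_action (Af r a b) ` mealy_states (Af r a b) = range (Af_state r a b)"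
    by (simp add: Af_def image_image Af_action[unfolded Af_def])
  then show ?thesis
    by (simp add: automaton_group_def)
qed


section \<open>Group-theoretic notions\<close>

definition has_finite_order :: "('g, 'm) monoid_scheme \<Rightarrow> 'g \<Rightarrow> bool" where
  "has_finite_order G x \<longleftrightarrow> (\<exists>k::nat. 0 < k \<and> x [^]\<^bsub>G\<^esub> k = \<one>\<^bsub>G\<^esub>)"

text \<open>Only a group when the elements of finite order form a subgroup.\<close>

definition torsion_part :: "('g, 'm) monoid_scheme \<Rightarrow> ('g, 'm) monoid_scheme" where
  "torsion_part G = G\<lparr>carrier := {x \<in> carrier G. has_finite_order G x}\<rparr>"

definition annihilated_by :: "('g, 'm) monoid_scheme \<Rightarrow> int \<Rightarrow> bool" where
  "annihilated_by G s \<longleftrightarrow> (\<forall>x \<in> carrier G. x [^]\<^bsub>G\<^esub> s = \<one>\<^bsub>G\<^esub>)"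

definition additive_group :: "'a::ab_group_add monoid" where
  "additive_group = \<lparr>carrier = UNIV, monoid.mult = (+), one = 0\<rparr>"

definition semidirect_product ::
    "('n, 'm) monoid_scheme \<Rightarrow> ('h, 'l) monoid_scheme \<Rightarrow> ('h \<Rightarrow> 'n \<Rightarrow> 'n) \<Rightarrow> ('n \<times> 'h) monoid" where
  "semidirect_product N H \<phi> =
     \<lparr>carrier = carrier N \<times> carrier H,
      monoid.mult = (\<lambda>(x, h) (y, k). (x \<otimes>\<^bsub>N\<^esub> \<phi> h y, h \<otimes>\<^bsub>H\<^esub> k)),
      one = (\<one>\<^bsub>N\<^esub>, \<one>\<^bsub>H\<^esub>)\<rparr>"

text \<open>\<open>H\<close> acts on the direct sum by left translation of the index.\<close>

definition restricted_wreath ::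
    "('g, 'm) monoid_scheme \<Rightarrow> ('h, 'l) monoid_scheme \<Rightarrow> (('h \<Rightarrow> 'g) \<times> 'h) monoid" where
  "restricted_wreath G H =
     semidirect_product (sum_group (carrier H) (\<lambda>_. G)) H
       (\<lambda>h y. \<lambda>i\<in>carrier H. y (inv\<^bsub>H\<^esub> h \<otimes>\<^bsub>H\<^esub> i))"

end

theory Submission
  imports Defs
begin

text \<open>
  With \<open>e = b f - r a = r (b - a) / (1 - b t)\<close>, the state with parameter \<open>s\<close> is the affine map
  \<open>g \<mapsto> f g + s e\<close>. Composing with the inverse of the state \<open>\<mu>\<^sub>f\<close> yields the translation by \<open>s e\<close>, and
  conjugating by powers of \<open>\<mu>\<^sub>f\<close> the translations by \<open>s e f\<^sup>m\<close>. So the automaton group consists exactly of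
  the maps \<open>g \<mapsto> f\<^sup>m g + h\<close> with \<open>m\<close> an integer and \<open>h\<close> in the additive span \<open>E\<close> of the
  series \<open>s e f\<^sup>m\<close> (\<open>aff_set_generate\<close>).

  If \<open>f\<^sup>K = 1\<close>, only finitely many powers of \<open>f\<close> exist, \<open>E\<close> is spanned by finitely many elements
  over the finite ring \<open>R\<close>, and the group is finite (\<open>finite_aff_set\<close>), whereas the wreath product is infinite.

  If no positive power of \<open>f\<close> is \<open>1\<close>, then \<open>m\<close> must vanish for a torsion element, since the \<open>k\<close>-th
  power of \<open>g \<mapsto> f\<^sup>m g + h\<close> has multiplier \<open>f\<close> to the power \<open>k m\<close>; conversely every translation is killed by
  \<open>n\<close> (\<open>aff_finite_order_iff\<close>). So the torsion part is the group of translations by \<open>E\<close>. Every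
  element of \<open>E\<close> is a multiple of \<open>e\<close>, hence of the constant \<open>r (b - a)\<close>. This constant is not a
  unit, so in the finite ring \<open>R\<close> it is a zero divisor, and some \<open>0 < s < n\<close> annihilates it
  (\<open>nonunit_annihilated\<close>) and with it all torsion. Both the direct sum and the wreath product, however,
  contain an element of order exactly \<open>n\<close>, the indicator of one coordinate, which excludes an
  isomorphism in either case (\<open>not_iso_if_annihilated\<close>).
\<close>


section \<open>Integer powers of a unit\<close>

lemma unit_powi_0 [simp]: "unit_powi f 0 = 1"
  by (simp add: unit_powi_def)

lemma unit_powi_1 [simp]: "unit_powi f 1 = f"
  by (simp add: unit_powi_def)

lemma unit_powi_nonneg [simp]: "unit_powi f (int k) = f ^ k"
  by (simp add: unit_powi_def)

lemma the_inverse_eq: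
  fixes f u :: "'a::comm_ring_1"
  assumes "f * u = 1"
  shows "(THE v. f * v = 1) = u"
proof (rule the_equality)
  show "v = u" if "f * v = 1" for v
    using assms that by (metis mult.assoc mult.commute mult_1_left)
qed (fact assms)

lemma unit_powi_neg:
  fixes f u :: "'a::comm_ring_1"
  assumes "f * u = 1"
  shows "unit_powi f (- int k) = u ^ k"
  by (cases "k = 0") (simp_all add: unit_powi_def the_inverse_eq[OF assms])

lemma unit_powi_succ:
  fixes f :: "'a::comm_ring_1"
  assumes "f dvd 1"
  shows "unit_powi f (m + 1) = f * unit_powi f m"
proof -
  obtain u where u: "f * u = 1"
    using assms by (metis dvdE)
  show ?thesis
  proof (cases m rule: int_cases)
    case (nonneg k)
    then show ?thesis
      using unit_powi_nonneg[of f "Suc k"] by (simp add: add.commute)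
  next
    case (neg k)
    have "unit_powi f (m + 1) = u ^ k"
      using unit_powi_neg[OF u, of k] by (simp add: neg)
    moreover have "unit_powi f m = u ^ Suc k"
      using unit_powi_neg[OF u, of "Suc k"] by (simp add: neg)
    ultimately show ?thesis
      by (simp add: mult.assoc[symmetric] u)
  qed
qed

lemma unit_powi_add:
  fixes f :: "'a::comm_ring_1"
  assumes "f dvd 1"
  shows "unit_powi f (m + k) = unit_powi f m * unit_powi f k"
proof (induction m rule: int_induct[where k = 0])
  case (step1 i)
  have "unit_powi f (i + 1 + k) = f * unit_powi f (i + k)"
    using unit_powi_succ[OF assms, of "i + k"] by (simp add: algebra_simps)
  then show ?case
    by (simp add: step1 unit_powi_succ[OF assms] mult.assoc)
next
  case (step2 i)
  obtain u where u: "u * f = 1"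
    using assms by (metis dvdE mult.commute)
  have shift: "unit_powi f (j - 1) = u * unit_powi f j" for j
    using unit_powi_succ[OF assms, of "j - 1"] by (simp add: mult.assoc[symmetric] u)
  have "unit_powi f (i - 1 + k) = u * unit_powi f (i + k)"
    using shift[of "i + k"] by (simp add: algebra_simps)
  then show ?case
    by (simp add: step2 shift mult.assoc)
qed simp


section \<open>Affine permutations of power series\<close>

lemma fps_perms_mult:
  "x \<in> carrier fps_perms \<Longrightarrow> y \<in> carrier fps_perms \<Longrightarrow> x \<otimes>\<^bsub>fps_perms\<^esub> y = x \<circ> y"
  by (auto simp: BijGroup_def compose_def fun_eq_iff)

lemma fps_perms_carrier: "x \<in> carrier fps_perms \<longleftrightarrow> bij x"
  by (simp add: BijGroup_def Bij_def)

lemma nat_pow_carrier_update: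
  "x [^]\<^bsub>G\<lparr>carrier := C\<rparr>\<^esub> (k::nat) = x [^]\<^bsub>G\<^esub> k"
  by (simp add: nat_pow_def)

text \<open>The series \<open>e\<close> is kept abstract: the structure of the group generated by the maps
  \<open>g \<mapsto> f g + s e\<close> depends only on \<open>f\<close> being a unit.\<close>

locale unit_affine =
  fixes f e :: "'a::comm_ring_1 fps"
  assumes f_unit: "f dvd 1"
begin

definition aff :: "int \<Rightarrow> 'a fps \<Rightarrow> 'a fps \<Rightarrow> 'a fps" where
  "aff m h g = unit_powi f m * g + h"

text \<open>The smallest additive subgroup containing all \<open>s e f\<^sup>m\<close>. Adding one generator at a time suffices,
  because the negative of a generator is again a generator, with \<open>- s\<close> in place of \<open>s\<close>.\<close>

inductive_set orbit_span :: "'a fps set" where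
  zero: "0 \<in> orbit_span"
| step: "h \<in> orbit_span \<Longrightarrow> fps_const s * e * unit_powi f m + h \<in> orbit_span"

definition aff_set :: "('a fps \<Rightarrow> 'a fps) set" where
  "aff_set = {aff m h | m h. h \<in> orbit_span}"

lemma orbit_span_add: "h \<in> orbit_span \<Longrightarrow> h' \<in> orbit_span \<Longrightarrow> h + h' \<in> orbit_span"
  by (induction rule: orbit_span.induct) (auto simp: add.assoc intro: orbit_span.step)

lemma orbit_span_uminus: "h \<in> orbit_span \<Longrightarrow> - h \<in> orbit_span"
proof (induction rule: orbit_span.induct)
  case (step h s m)
  have "fps_const (- s) * e * unit_powi f m + - h \<in> orbit_span"
    by (rule orbit_span.step[OF step.IH])
  then show ?case
    by (simp add: algebra_simps flip: fps_const_neg)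
qed (simp add: orbit_span.zero)

lemma orbit_span_powi: "h \<in> orbit_span \<Longrightarrow> unit_powi f k * h \<in> orbit_span"
proof (induction rule: orbit_span.induct)
  case (step h s m)
  have "fps_const s * e * unit_powi f (k + m) + unit_powi f k * h \<in> orbit_span"
    by (rule orbit_span.step[OF step.IH])
  then show ?case
    by (simp add: algebra_simps unit_powi_add[OF f_unit])
qed (simp add: orbit_span.zero)

lemma orbit_span_generator: "fps_const s * e * unit_powi f m \<in> orbit_span"
  using orbit_span.step[OF orbit_span.zero] by simp

lemma orbit_span_annihilated:
  assumes "c * e = 0" "h \<in> orbit_span"
  shows "c * h = 0"
  using assms(2)
proof induction
  case (step h s m)
  have "c * (fps_const s * e * unit_powi f m + h) = fps_const s * unit_powi f m * (c * e) + c * h"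
    by (simp add: algebra_simps)
  then show ?case
    by (simp add: step.IH assms(1))
qed simp

lemma aff_comp: "aff m h \<circ> aff k h' = aff (m + k) (unit_powi f m * h' + h)"
  by (auto simp: fun_eq_iff aff_def unit_powi_add[OF f_unit] algebra_simps)

lemma aff_id: "aff 0 0 = id"
  by (auto simp: fun_eq_iff aff_def)

lemma aff_bij: "bij (aff m h)"
proof -
  define i where "i = aff (- m) (- (unit_powi f (- m) * h))"
  have "unit_powi f m * unit_powi f (- m) = 1"
    using unit_powi_add[OF f_unit, of m "- m"] by simp
  then have "aff m h \<circ> i = id" "i \<circ> aff m h = id"
    by (simp_all add: i_def aff_comp flip: aff_id)
       (simp add: mult.assoc[symmetric])
  then show ?thesis
    using o_bij by blast
qed

lemma aff_carrier [simp]: "aff m h \<in> carrier fps_perms"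
  by (simp add: fps_perms_carrier aff_bij)

lemma aff_one: "\<one>\<^bsub>fps_perms\<^esub> = aff 0 0"
  by (auto simp: BijGroup_def aff_id)

lemma aff_mult [simp]:
  "aff m h \<otimes>\<^bsub>fps_perms\<^esub> aff k h' = aff (m + k) (unit_powi f m * h' + h)"
  by (simp add: fps_perms_mult aff_comp)

lemma aff_inv: "inv\<^bsub>fps_perms\<^esub> aff m h = aff (- m) (- (unit_powi f (- m) * h))"
  by (rule group.inv_equality[OF group_BijGroup]) (simp_all add: aff_one)

lemma aff_translation: "aff 0 h = fps_alpha h"
  by (simp add: fun_eq_iff aff_def fps_alpha_def add.commute)

lemma aff_mu: "aff 1 0 = fps_mu f"
  by (simp add: fun_eq_iff aff_def fps_mu_def)

text \<open>The translation part is recovered as the value at \<open>0\<close>, the multiplier then from the value at \<open>1\<close>.\<close>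

lemma aff_eqD: "aff m h = aff k h' \<Longrightarrow> unit_powi f m = unit_powi f k \<and> h = h'"
  by (metis add_0 add_right_cancel aff_def mult.right_neutral mult_zero_right)

lemma aff_pow_exponent: "\<exists>h'. aff m h [^]\<^bsub>fps_perms\<^esub> (k::nat) = aff (int k * m) h'"
proof (induction k)
  case (Suc k)
  then obtain h' where "aff m h [^]\<^bsub>fps_perms\<^esub> k = aff (int k * m) h'" ..
  then have "aff m h [^]\<^bsub>fps_perms\<^esub> Suc k = aff (int k * m + m) (unit_powi f (int k * m) * h + h')"
    by simp
  also have "int k * m + m = int (Suc k) * m"
    by (simp add: algebra_simps)
  finally show ?case ..
qed (auto simp: aff_one)

lemma translation_pow: "aff 0 h [^]\<^bsub>fps_perms\<^esub> (k::nat) = aff 0 (of_nat k * h)"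
  by (induction k) (simp_all add: aff_one algebra_simps)

lemma mu_pow: "aff m 0 [^]\<^bsub>fps_perms\<^esub> (k::nat) = aff (int k * m) 0"
  by (induction k) (simp_all add: aff_one algebra_simps)

lemma mu_finite_order_iff:
  "has_finite_order fps_perms (fps_mu f) \<longleftrightarrow> (\<exists>k>0. f ^ k = 1)"
proof -
  have "fps_mu f [^]\<^bsub>fps_perms\<^esub> k = \<one>\<^bsub>fps_perms\<^esub> \<longleftrightarrow> f ^ k = 1" for k :: nat
  proof -
    have "fps_mu f [^]\<^bsub>fps_perms\<^esub> k = aff (int k) 0"
      using mu_pow[of 1 k] by (simp add: aff_mu)
    moreover have "aff (int k) 0 = aff 0 0 \<longleftrightarrow> f ^ k = 1"
      using aff_eqD[of "int k" 0 0 0] by (auto simp: fun_eq_iff aff_def)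
    ultimately show ?thesis
      by (simp add: aff_one)
  qed
  then show ?thesis
    by (simp add: has_finite_order_def)
qed

text \<open>An element with \<open>m \<noteq> 0\<close> of finite order would give \<open>f\<close> a relation \<open>f\<^sup>j = 1\<close> with \<open>j \<noteq> 0\<close>, and
  passing to the inverse one may take \<open>j > 0\<close>. Conversely, the characteristic of the ring bounds
  the order of a translation.\<close>

lemma aff_finite_order_iff:
  assumes "\<And>k. k > 0 \<Longrightarrow> f ^ k \<noteq> 1" and "of_nat N = (0::'a fps)" "N > 0"
  shows "has_finite_order fps_perms (aff m h) \<longleftrightarrow> m = 0"
proof
  assume "has_finite_order fps_perms (aff m h)"
  then obtain k :: nat where k: "k > 0" "aff m h [^]\<^bsub>fps_perms\<^esub> k = aff 0 0"
    by (auto simp: has_finite_order_def aff_one)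
  then have km: "unit_powi f (int k * m) = 1"
    using aff_pow_exponent[of m h k] aff_eqD by (metis unit_powi_0)
  then have "unit_powi f (- (int k * m)) = 1"
    using unit_powi_add[OF f_unit, of "int k * m" "- (int k * m)"] by simp
  with km have "unit_powi f \<bar>int k * m\<bar> = 1"
    by (auto simp: abs_if)
  then have "f ^ nat \<bar>int k * m\<bar> = 1"
    by (metis abs_ge_zero int_nat_eq unit_powi_nonneg)
  then have "nat \<bar>int k * m\<bar> = 0"
    using assms(1) by blast
  then show "m = 0"
    using k(1) by simp
next
  assume "m = 0"
  then have "aff m h [^]\<^bsub>fps_perms\<^esub> N = \<one>\<^bsub>fps_perms\<^esub>"
    by (simp add: translation_pow assms(2) aff_one)
  then show "has_finite_order fps_perms (aff m h)"
    using assms(3) by (auto simp: has_finite_order_def)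
qed

text \<open>Translations compose by addition, so the translations by the span of a set are generated by
  the translations by that set.\<close>

lemma translations_generate:
  "{aff 0 h | h. h \<in> orbit_span}
    = generate fps_perms {fps_alpha (fps_const s * e * unit_powi f m) | m s. True}"
    (is "_ = generate _ ?S")
proof (intro subset_antisym subsetI)
  fix x assume "x \<in> {aff 0 h | h. h \<in> orbit_span}"
  then obtain h where "h \<in> orbit_span" "x = aff 0 h"
    by blast
  then show "x \<in> generate fps_perms ?S"
  proof (induction arbitrary: x)
    case zero
    then show ?case
      by (simp add: aff_one[symmetric] generate.one)
  next
    case (step h s m)
    have "aff 0 (fps_const s * e * unit_powi f m) \<in> generate fps_perms ?S"
      by (rule generate.incl) (auto simp: aff_translation)
    from generate.eng[OF this step.IH[OF refl]] show ?case
      by (simp add: step.prems add.commute)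
  qed
next
  fix x assume "x \<in> generate fps_perms ?S"
  then show "x \<in> {aff 0 h | h. h \<in> orbit_span}"
  proof induction
    case one
    then show ?case
      using orbit_span.zero by (auto simp: aff_one)
  next
    case (incl h)
    then show ?case
      using orbit_span_generator by (auto simp flip: aff_translation)
  next
    case (inv h)
    then obtain s m where "h = aff 0 (fps_const s * e * unit_powi f m)"
      by (auto simp: aff_translation)
    then have "inv\<^bsub>fps_perms\<^esub> h = aff 0 (- (fps_const s * e * unit_powi f m))"
      by (simp add: aff_inv)
    then show ?case
      using orbit_span_uminus[OF orbit_span_generator] by blast
  next
    case (eng x y)
    then obtain h k where "x = aff 0 h" "y = aff 0 k" "h \<in> orbit_span" "k \<in> orbit_span"
      by blast
    then show ?case
      using orbit_span_add by auto
  qed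
qed

text \<open>The right-hand side is closed under composition because \<open>E\<close> is stable under multiplication by powers
  of \<open>f\<close>. Conversely \<open>s = 0\<close> gives \<open>\<mu>\<^sub>f\<close> among the generators, which separates the linear part of each
  generator from its translation part; conjugating the translation by \<open>s e\<close> with \<open>\<mu>\<^sub>f\<close> to the power
  \<open>m\<close> gives the translation by \<open>s e f\<^sup>m\<close>.\<close>

lemma aff_set_generate:
  "generate fps_perms (range (\<lambda>s. aff 1 (fps_const s * e))) = aff_set" (is "generate _ ?S = _")
proof (intro subset_antisym subsetI)
  fix x assume "x \<in> generate fps_perms ?S"
  then show "x \<in> aff_set"
  proof induction
    case one
    then show ?case
      using orbit_span.zero by (auto simp: aff_one aff_set_def)
  next
    case (incl h)
    then show ?case
      using orbit_span_generator[of _ 0] by (auto simp: aff_set_def)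
  next
    case (inv h)
    then obtain s where "h = aff 1 (fps_const s * e)"
      by blast
    moreover have "- (unit_powi f (- 1) * (fps_const s * e)) \<in> orbit_span"
      using orbit_span_generator[of s 0] by (intro orbit_span_uminus orbit_span_powi) simp
    ultimately show ?case
      by (auto simp: aff_inv aff_set_def)
  next
    case (eng x y)
    then show ?case
      by (auto simp: aff_set_def) (blast intro: orbit_span_add orbit_span_powi)
  qed
next
  interpret gen: subgroup "generate fps_perms ?S" "fps_perms :: ('a fps \<Rightarrow> 'a fps) monoid"
    by (rule group.generate_is_subgroup[OF group_BijGroup]) auto
  note mult = gen.m_closed
  have gen: "aff 1 (fps_const s * e) \<in> generate fps_perms ?S" for s
    by (intro generate.incl) blast
  have one: "aff 1 0 \<in> generate fps_perms ?S"
    using gen[of 0] by simp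
  have minus: "aff (- 1) 0 \<in> generate fps_perms ?S"
    using gen.m_inv_closed[OF one] by (simp add: aff_inv)
  have powers: "aff m 0 \<in> generate fps_perms ?S" for m
  proof (induction m rule: int_induct[where k = 0])
    case base
    show ?case
      using gen.one_closed by (simp add: aff_one)
  next
    case (step1 i)
    show ?case
      using mult[OF step1(2) one] by simp
  next
    case (step2 i)
    show ?case
      using mult[OF step2(2) minus] by simp
  qed
  have basic: "aff 0 (fps_const s * e) \<in> generate fps_perms ?S" for s
    using mult[OF gen minus] by simp
  have conjugates: "aff 0 (fps_const s * e * unit_powi f m) \<in> generate fps_perms ?S" for s m
    using mult[OF mult[OF powers[of m] basic[of s]] powers[of "- m"]]
    by (simp add: mult_ac)
  fix x assume "x \<in> aff_set"
  then obtain m h where x: "x = aff m h" and h: "h \<in> orbit_span"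
    by (auto simp: aff_set_def)
  from h have "aff 0 h \<in> generate fps_perms ?S"
  proof induction
    case zero
    show ?case
      by (rule powers)
  next
    case (step h s m)
    show ?case
      using mult[OF conjugates step.IH] by (simp add: add.commute)
  qed
  from mult[OF this powers[of m]] show "x \<in> generate fps_perms ?S"
    by (simp add: x)
qed

end

text \<open>The ring \<open>S\<close> generated by \<open>f\<close> over the coefficients is spanned by \<open>1, f, \<dots>\<close> up to the power
  \<open>K - 1\<close>, hence finite, and it contains the inverse of \<open>f\<close>, which is a power of \<open>f\<close>. All multipliers lie
  in \<open>S\<close> and all translation parts in \<open>e S\<close>.\<close>

lemma finite_aff_set:
  fixes f :: "'a::{comm_ring_1,finite} fps"
  assumes "f ^ K = 1" "K > 0"
  shows "finite (unit_affine.aff_set f e)"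
proof -
  obtain l where K: "K = Suc l"
    using assms(2) gr0_implies_Suc by blast
  have inverse: "f * f ^ l = 1"
    using assms(1) by (simp add: K)
  interpret unit_affine f e
    by unfold_locales (metis inverse dvdI)
  define S where "S = range (\<lambda>c. \<Sum>j<K. fps_const (c j :: 'a) * f ^ j)"
  have "S \<subseteq> (\<lambda>c. \<Sum>j<K. fps_const (c j) * f ^ j) ` (\<Pi>\<^sub>E j\<in>{..<K}. (UNIV :: 'a set))"
  proof
    fix x assume "x \<in> S"
    then obtain c where "x = (\<Sum>j<K. fps_const (c j) * f ^ j)"
      by (auto simp: S_def)
    then have "x = (\<Sum>j<K. fps_const (restrict c {..<K} j) * f ^ j)"
      by simp
    then show "x \<in> (\<lambda>c. \<Sum>j<K. fps_const (c j) * f ^ j) ` (\<Pi>\<^sub>E j\<in>{..<K}. (UNIV :: 'a set))"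
      by (intro image_eqI[of _ _ "restrict c {..<K}"]) auto
  qed
  then have fin: "finite S"
    by (rule finite_subset) (intro finite_imageI finite_PiE finite_lessThan finite)
  have combination: "(\<Sum>j<K. fps_const (c j) * f ^ j) \<in> S" for c :: "nat \<Rightarrow> 'a"
    unfolding S_def by (rule rangeI)
  have add: "x + y \<in> S" if "x \<in> S" "y \<in> S" for x y
  proof -
    from that obtain c d where "x = (\<Sum>j<K. fps_const (c j) * f ^ j)" "y = (\<Sum>j<K. fps_const (d j) * f ^ j)"
      by (auto simp: S_def)
    then have "x + y = (\<Sum>j<K. fps_const (c j + d j) * f ^ j)"
      by (simp add: sum.distrib algebra_simps flip: fps_const_add)
    then show ?thesis
      by (simp only: combination)
  qed
  have scale: "fps_const s * x \<in> S" if "x \<in> S" for s x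
  proof -
    from that obtain c where "x = (\<Sum>j<K. fps_const (c j) * f ^ j)"
      by (auto simp: S_def)
    then have "fps_const s * x = (\<Sum>j<K. fps_const (s * c j) * f ^ j)"
      by (simp add: sum_distrib_left mult.assoc flip: fps_const_mult)
    then show ?thesis
      by (simp only: combination)
  qed
  have shift: "f * x \<in> S" if "x \<in> S" for x
  proof -
    from that obtain c where x: "x = (\<Sum>j<K. fps_const (c j) * f ^ j)"
      by (auto simp: S_def)
    \<comment> \<open>Multiplication by \<open>f\<close> rotates the coefficients cyclically, since the top power wraps around to \<open>1\<close>.\<close>
    define d where "d j = (case j of 0 \<Rightarrow> c l | Suc i \<Rightarrow> c i)" for j
    have "f * (fps_const (c l) * f ^ l) = fps_const (c l)"
      by (subst mult.left_commute) (simp add: inverse)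
    then have "f * x = (\<Sum>j<l. fps_const (c j) * f ^ Suc j) + fps_const (c l)"
      by (simp add: x K distrib_left sum_distrib_left mult.left_commute)
    also have "\<dots> = (\<Sum>j<K. fps_const (d j) * f ^ j)"
      unfolding K by (subst sum.lessThan_Suc_shift) (simp add: d_def)
    finally show ?thesis
      by (simp only: combination)
  qed
  have one: "1 \<in> S"
  proof -
    have "(\<Sum>j<K. fps_const (if j = 0 then 1 else 0) * f ^ j) = 1"
      unfolding K by (subst sum.lessThan_Suc_shift) simp
    then show ?thesis
      using combination[of "\<lambda>j. if j = 0 then 1 else 0"] by (simp only:)
  qed
  have zero: "0 \<in> S"
    using scale[OF one, of 0] by simp
  have pow: "f ^ j \<in> S" for j
    by (induction j) (simp_all add: one shift)
  have powi: "unit_powi f m \<in> S" for m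
  proof (cases m rule: int_cases2)
    case (nonpos k)
    then show ?thesis
      using unit_powi_neg[OF inverse] pow by (simp flip: power_mult)
  qed (simp add: pow)
  have "\<exists>p\<in>S. h = e * p" if "h \<in> orbit_span" for h
    using that
  proof induction
    case zero
    show ?case
      using \<open>0 \<in> S\<close> by (intro bexI[of _ 0]) auto
  next
    case (step h s m)
    then obtain p where p: "p \<in> S" "h = e * p"
      by blast
    show ?case
    proof (rule bexI)
      show "fps_const s * e * unit_powi f m + h = e * (fps_const s * unit_powi f m + p)"
        by (simp add: p algebra_simps)
    qed (intro add scale powi p)
  qed
  then have "aff_set \<subseteq> (\<lambda>(q, p) g. q * g + e * p) ` (S \<times> S)"
    using powi by (fastforce simp: aff_set_def aff_def[abs_def])
  then show ?thesis
    by (rule finite_subset) (intro finite_imageI finite_cartesian_product fin)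
qed


section \<open>Non-units of a residue ring\<close>

text \<open>Multiplication by a non-unit misses \<open>1\<close>, so on a finite ring it is not injective either; every
  element of the residue ring is an integer multiple of \<open>1\<close>, so the annihilator can be taken to be an integer.\<close>

lemma nonunit_annihilated:
  fixes d :: "'n::nontriv mod_ring"
  assumes "\<not> d dvd 1"
  shows "\<exists>s::nat. 0 < s \<and> s < CARD('n) \<and> of_nat s * d = 0"
proof -
  have "\<not> surj ((*) d)"
  proof
    assume "surj ((*) d)"
    then obtain x where "1 = d * x"
      by (metis surjD)
    then show False
      using assms by (metis dvdI)
  qed
  then have "\<not> inj ((*) d)"
    using finite_UNIV_inj_surj[of "(*) d"] by auto
  then obtain x y where "d * x = d * y" "x \<noteq> y"
    by (auto simp: inj_def)
  then obtain z where z: "d * z = 0" "z \<noteq> 0"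
    by (metis right_diff_distrib right_minus_eq)
  define s where "s = to_int_mod_ring z"
  have range: "s \<in> {0..<int CARD('n)}"
    using range_to_int_mod_ring[where ?'a = 'n] by (auto simp: s_def)
  have "of_int s = z"
    by (simp add: s_def of_int_of_int_mod_ring)
  moreover from this have "s \<noteq> 0"
    using z(2) by auto
  ultimately have "0 < nat s \<and> nat s < CARD('n) \<and> of_nat (nat s) * d = 0"
    using range z(1) by (auto simp: mult.commute)
  then show ?thesis ..
qed

lemma of_nat_mod_ring_nonzero:
  assumes "0 < s" "s < CARD('n::nontriv)"
  shows "(of_nat s :: 'n mod_ring) \<noteq> 0"
proof
  assume "(of_nat s :: 'n mod_ring) = 0"
  then have "to_int_mod_ring (of_int_mod_ring (int s) :: 'n mod_ring) = to_int_mod_ring (0 :: 'n mod_ring)"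
    by (simp add: of_nat_of_int_mod_ring)
  then show False
    using assms to_int_mod_ring_of_int_mod_ring[where ?'a = 'n, of "int s"]
    by (simp add: to_int_mod_ring_hom.hom_zero)
qed


section \<open>Elements of full order in direct sums and wreath products\<close>

text \<open>Powers are compared from exponent \<open>1\<close> on, and the target is required to have a left unit
  law only at \<open>\<phi> y\<close>; thus the lemma applies to the wreath product without verifying its group axioms.\<close>

lemma hom_pow_Suc:
  assumes "monoid G" "\<phi> \<in> hom G H" "y \<in> carrier G" "\<one>\<^bsub>H\<^esub> \<otimes>\<^bsub>H\<^esub> \<phi> y = \<phi> y"
  shows "\<phi> (y [^]\<^bsub>G\<^esub> Suc k) = \<phi> y [^]\<^bsub>H\<^esub> Suc k"
proof (induction k)
  case 0
  interpret monoid G by fact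
  show ?case
    using assms(3,4) by simp
next
  case (Suc k)
  interpret monoid G by fact
  have "\<phi> (y [^]\<^bsub>G\<^esub> Suc k \<otimes>\<^bsub>G\<^esub> y) = \<phi> (y [^]\<^bsub>G\<^esub> Suc k) \<otimes>\<^bsub>H\<^esub> \<phi> y"
    using hom_mult[OF assms(2)] assms(3) nat_pow_closed by blast
  then show ?case
    using Suc.IH by simp
qed

text \<open>An element \<open>x\<close> with \<open>x\<^sup>N = 1\<close> but \<open>x\<^sup>s \<noteq> 1\<close> cannot correspond to an element of \<open>G\<close> if \<open>s\<close>
  annihilates the torsion of \<open>G\<close>. The equations are stated after multiplication by \<open>x\<close>,
  so that no cancellation in \<open>H\<close> is needed.\<close>

lemma not_iso_if_annihilated:
  assumes "group G"
    and ann: "\<And>y. y \<in> carrier G \<Longrightarrow> has_finite_order G y \<Longrightarrow> y [^]\<^bsub>G\<^esub> s = \<one>\<^bsub>G\<^esub>"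
    and x: "x \<in> carrier H" "\<one>\<^bsub>H\<^esub> \<otimes>\<^bsub>H\<^esub> x = x"
    and N: "N > 0" "x [^]\<^bsub>H\<^esub> Suc N = x"
    and s: "x [^]\<^bsub>H\<^esub> Suc s \<noteq> x"
  shows "\<not> G \<cong> H"
proof
  interpret group G by fact
  assume "G \<cong> H"
  then obtain \<phi> where \<phi>: "\<phi> \<in> hom G H" "bij_betw \<phi> (carrier G) (carrier H)"
    by (auto simp: is_iso_def iso_def)
  then obtain y where y: "y \<in> carrier G" "\<phi> y = x"
    using x(1) by (metis bij_betw_imp_surj_on imageE)
  have pow: "\<phi> (y [^]\<^bsub>G\<^esub> Suc k) = x [^]\<^bsub>H\<^esub> Suc k" for k
    using hom_pow_Suc[OF monoid_axioms \<phi>(1) y(1)] x(2) y(2) by simp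
  have "y [^]\<^bsub>G\<^esub> Suc N = y"
    using pow[of N] N(2) y \<phi>(2) by (metis bij_betw_imp_inj_on inj_onD nat_pow_closed)
  then have "y [^]\<^bsub>G\<^esub> N = \<one>\<^bsub>G\<^esub>"
    using y(1) by (metis nat_pow_Suc nat_pow_closed r_cancel_one)
  then have "y [^]\<^bsub>G\<^esub> s = \<one>\<^bsub>G\<^esub>"
    using ann y(1) N(1) by (auto simp: has_finite_order_def)
  then have "y [^]\<^bsub>G\<^esub> Suc s = y"
    using y(1) by simp
  then show False
    using pow[of s] s y(2) by simp
qed

lemma group_additive_group: "group (additive_group :: 'a::ab_group_add monoid)"
  by (rule groupI) (auto simp: additive_group_def add.assoc intro: exI[of _ "- _"] left_minus)

definition single_one :: "int \<Rightarrow> 'a::comm_ring_1" where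
  "single_one i = (if i = 0 then 1 else 0)"

abbreviation direct_sum :: "(int \<Rightarrow> 'a::comm_ring_1) monoid" where
  "direct_sum \<equiv> sum_group UNIV (\<lambda>_. additive_group)"

lemma direct_sum_ops:
  "x \<in> carrier (direct_sum :: (int \<Rightarrow> 'a::comm_ring_1) monoid) \<longleftrightarrow> finite {i. x i \<noteq> 0}"
  "x \<otimes>\<^bsub>direct_sum\<^esub> y = (\<lambda>i. x i + y i)"
  "\<one>\<^bsub>direct_sum\<^esub> = (\<lambda>i. 0 :: 'a)"
  by (simp_all add: carrier_sum_group group_additive_group) (simp_all add: additive_group_def restrict_def)

lemma single_one_direct_sum:
  "single_one \<in> carrier direct_sum"
  "\<one>\<^bsub>direct_sum\<^esub> \<otimes>\<^bsub>direct_sum\<^esub> single_one = single_one"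
  "single_one [^]\<^bsub>direct_sum\<^esub> (k::nat) = (\<lambda>i. of_nat k * single_one i)"
proof -
  show "single_one \<in> carrier direct_sum"
    by (simp add: direct_sum_ops(1) single_one_def)
  show "\<one>\<^bsub>direct_sum\<^esub> \<otimes>\<^bsub>direct_sum\<^esub> single_one = single_one"
    by (simp only: direct_sum_ops) simp
  show "single_one [^]\<^bsub>direct_sum\<^esub> (k::nat) = (\<lambda>i. of_nat k * single_one i)"
    by (induction k) (simp_all only: nat_pow_0 nat_pow_Suc direct_sum_ops, simp_all add: algebra_simps)
qed

lemma wreath_ops:
  "w \<in> carrier (restricted_wreath (additive_group :: 'a::comm_ring_1 monoid) integer_group)
    \<longleftrightarrow> finite {i. fst w i \<noteq> 0}"
  "(x, m) \<otimes>\<^bsub>restricted_wreath (additive_group :: 'a::comm_ring_1 monoid) integer_group\<^esub> (y, k)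
    = ((\<lambda>i. x i + y (i - m)), m + k)"
  "\<one>\<^bsub>restricted_wreath (additive_group :: 'a::comm_ring_1 monoid) integer_group\<^esub> = ((\<lambda>i. 0), 0)"
  unfolding restricted_wreath_def semidirect_product_def
  using direct_sum_ops(1)[of "fst w"]
  by (auto simp: mem_Times_iff additive_group_def algebra_simps fun_eq_iff)

lemma single_one_wreath:
  fixes W defines "W \<equiv> restricted_wreath (additive_group :: 'a::comm_ring_1 monoid) integer_group"
  shows "(single_one, 0) \<in> carrier W"
    and "\<one>\<^bsub>W\<^esub> \<otimes>\<^bsub>W\<^esub> (single_one, 0) = (single_one, 0)"
    and "(single_one, 0) [^]\<^bsub>W\<^esub> (k::nat) = ((\<lambda>i. of_nat k * single_one i), 0)"
proof -
  show "(single_one, 0) \<in> carrier W"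
    by (simp add: W_def wreath_ops(1) single_one_def)
  show "\<one>\<^bsub>W\<^esub> \<otimes>\<^bsub>W\<^esub> (single_one, 0) = (single_one, 0)"
    by (simp add: W_def wreath_ops)
  show "(single_one, 0) [^]\<^bsub>W\<^esub> (k::nat) = ((\<lambda>i. of_nat k * single_one i), 0)"
    unfolding W_def by (induction k) (simp_all add: wreath_ops algebra_simps)
qed

lemma infinite_wreath:
  "infinite (carrier (restricted_wreath (additive_group :: 'a::comm_ring_1 monoid) integer_group))"
proof
  assume "finite (carrier (restricted_wreath (additive_group :: 'a monoid) integer_group))"
  moreover have "range (\<lambda>m::int. ((\<lambda>i::int. 0 :: 'a), m))
      \<subseteq> carrier (restricted_wreath (additive_group :: 'a monoid) integer_group)"
    by (auto simp: wreath_ops(1))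
  ultimately have "finite (range (\<lambda>m::int. ((\<lambda>i::int. 0 :: 'a), m)))"
    by (rule rev_finite_subset)
  then have "finite (UNIV :: int set)"
    by (rule finite_imageD) (simp add: inj_on_def)
  then show False
    by simp
qed

lemma of_nat_single_one_iff:
  "(\<lambda>i. of_nat (Suc k) * single_one i) = (single_one :: int \<Rightarrow> 'a::comm_ring_1)
    \<longleftrightarrow> (of_nat k :: 'a) = 0"
proof
  assume "(\<lambda>i. of_nat (Suc k) * single_one i) = (single_one :: int \<Rightarrow> 'a)"
  from fun_cong[OF this, of 0] show "(of_nat k :: 'a) = 0"
    by (simp add: single_one_def)
qed (simp add: fun_eq_iff single_one_def)


section \<open>The automaton group\<close>

lemma moebius_fps_unit:
  assumes "r dvd 1"
  shows "moebius_fps r a b dvd 1"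
proof -
  have "fps_const r dvd 1"
    using assms by (metis dvd_def fps_const_1_eq_1 fps_const_mult)
  moreover have "(1 - fps_const a * fps_X) dvd 1" "fps_geom b dvd 1"
    using one_minus_X_geom by (metis dvd_triv_left, metis dvd_triv_right)
  ultimately have "fps_const r * ((1 - fps_const a * fps_X) * fps_geom b) dvd 1 * (1 * 1)"
    by (intro mult_dvd_mono)
  then show ?thesis
    by (simp add: moebius_fps_def)
qed

lemma automaton_group_carrier:
  assumes "r dvd 1" and e: "e = fps_const (r * (b - a)) * fps_geom b"
  shows "automaton_group (Af r a b)
    = fps_perms\<lparr>carrier := unit_affine.aff_set (moebius_fps r a b) e\<rparr>"
proof -
  interpret unit_affine "moebius_fps r a b" e
    by unfold_locales (rule moebius_fps_unit[OF assms(1)])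
  have "Af_state r a b s = aff 1 (fps_const s * e)" for s
    by (simp add: fun_eq_iff aff_def Af_state_eq e mult.assoc flip: fps_const_mult)
  then have "range (Af_state r a b) = range (\<lambda>s. aff 1 (fps_const s * e))"
    by simp
  moreover have "carrier fps_perms \<inter> range (\<lambda>s. aff 1 (fps_const s * e)) = range (\<lambda>s. aff 1 (fps_const s * e))"
    by auto
  ultimately show ?thesis
    by (simp add: automaton_group_Af subgroup_generated_def aff_set_generate)
qed

theorem mainTheorem5:
  fixes n :: nat
    and r a b :: "'n::nontriv mod_ring"
    and f :: "'n mod_ring fps"
    and G :: "('n mod_ring fps \<Rightarrow> 'n mod_ring fps) monoid"
  assumes "n = CARD('n)"
    and "r dvd 1"
    and "\<not> (a - b) dvd 1"
    and "f = moebius_fps r a b"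
    and "G = automaton_group (Af r a b)"
  shows "(has_finite_order fps_perms (fps_mu f) \<longrightarrow> finite (carrier G))
    \<and> (has_finite_order fps_perms (fps_mu f)
       \<or> (carrier (torsion_part G)
            = generate fps_perms
                {fps_alpha (fps_const s' * (- fps_const (a * r) + fps_const b * f) * unit_powi f m)
                  | m s'. True}
          \<and> (\<exists>s. 0 < s \<and> s < int n \<and> annihilated_by (torsion_part G) s)
          \<and> \<not> torsion_part G \<cong> sum_group (UNIV :: int set) (\<lambda>_. additive_group :: 'n mod_ring monoid)))
    \<and> \<not> G \<cong> restricted_wreath (additive_group :: 'n mod_ring monoid) integer_group"
proof -
  define e where "e = fps_const (r * (b - a)) * fps_geom b"
  interpret unit_affine f e
    by unfold_locales (simp add: assms(4) moebius_fps_unit[OF assms(2)])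
  have e: "- fps_const (a * r) + fps_const b * f = e"
    using moebius_diff[of b r a] by (simp add: assms(4) e_def mult.commute[of a r] del: fps_const_neg)
  have G: "G = fps_perms\<lparr>carrier := aff_set\<rparr>"
    unfolding assms(4,5) by (rule automaton_group_carrier[OF assms(2) e_def])
  have group: "group G"
    unfolding assms(5) automaton_group_def
    by (rule group.group_subgroup_generated[OF group_BijGroup])
  have pow: "x [^]\<^bsub>G\<^esub> (k::nat) = x [^]\<^bsub>fps_perms\<^esub> k" for x k
    by (simp add: G nat_pow_carrier_update)
  have order: "has_finite_order G x \<longleftrightarrow> has_finite_order fps_perms x" for x
    unfolding has_finite_order_def pow by (simp add: G)
  show ?thesis
  proof (cases "has_finite_order fps_perms (fps_mu f)")
    case True
    then obtain K where "K > 0" "f ^ K = 1"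
      by (auto simp: mu_finite_order_iff)
    then have fin: "finite (carrier G)"
      using finite_aff_set by (simp add: G)
    moreover have "\<not> G \<cong> restricted_wreath (additive_group :: 'n mod_ring monoid) integer_group"
    proof
      assume "G \<cong> restricted_wreath (additive_group :: 'n mod_ring monoid) integer_group"
      then show False
        using fin infinite_wreath[where ?'a = "'n mod_ring"] bij_betw_finite
        by (auto simp: is_iso_def iso_def)
    qed
    ultimately show ?thesis
      using True by blast
  next
    case False
    then have infinite_order: "\<And>k. k > 0 \<Longrightarrow> f ^ k \<noteq> 1"
      unfolding mu_finite_order_iff by blast
    have n: "n > 0" "of_nat n = (0 :: 'n mod_ring)"
      by (simp_all add: assms(1))
    then have char: "of_nat n = (0 :: 'n mod_ring fps)"
      by (simp add: fps_of_nat[symmetric])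
    have torsion: "carrier (torsion_part G) = {aff 0 h | h. h \<in> orbit_span}"
      using aff_finite_order_iff[OF infinite_order char n(1)]
      by (auto simp: torsion_part_def order) (auto simp: G aff_set_def)
    have "\<not> (b - a) dvd 1"
      using assms(3) by (metis minus_diff_eq minus_dvd_iff)
    then have "\<not> r * (b - a) dvd 1"
      by (metis dvd_mult_right)
    then obtain s :: nat where s: "0 < s" "s < n" "of_nat s * (r * (b - a)) = 0"
      using nonunit_annihilated assms(1) by blast
    have "of_nat s * e = fps_const (of_nat s * (r * (b - a))) * fps_geom b"
      by (simp add: e_def mult.assoc fps_of_nat[symmetric] del: fps_of_nat flip: fps_const_mult)
    then have "of_nat s * e = 0"
      by (simp add: s(3))
    then have ann: "x [^]\<^bsub>fps_perms\<^esub> s = \<one>\<^bsub>fps_perms\<^esub>" if "x \<in> carrier (torsion_part G)" for x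
      using that orbit_span_annihilated[of "of_nat s"] by (auto simp: torsion translation_pow aff_one)
    have full_order: "(of_nat s :: 'n mod_ring) \<noteq> 0"
      using of_nat_mod_ring_nonzero s(1,2) assms(1) by blast
    have tpow: "x [^]\<^bsub>torsion_part G\<^esub> (k::nat) = x [^]\<^bsub>fps_perms\<^esub> k" for x k
      by (simp add: torsion_part_def pow nat_pow_carrier_update)
    have tone: "\<one>\<^bsub>torsion_part G\<^esub> = \<one>\<^bsub>fps_perms\<^esub>"
      by (simp add: torsion_part_def G)
    have generated: "carrier (torsion_part G) = generate fps_perms
        {fps_alpha (fps_const s' * (- fps_const (a * r) + fps_const b * f) * unit_powi f m) | m s'. True}"
      unfolding torsion e by (rule translations_generate)
    have annihilated: "annihilated_by (torsion_part G) (int s)"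
      using ann by (simp add: annihilated_by_def int_pow_int tpow tone)
    have "subgroup (carrier (torsion_part G)) fps_perms"
      unfolding generated
      by (rule group.generate_is_subgroup[OF group_BijGroup]) (auto simp flip: aff_translation)
    then have "group (fps_perms\<lparr>carrier := carrier (torsion_part G)\<rparr>)"
      by (rule subgroup.subgroup_is_group[OF _ group_BijGroup])
    then have tgroup: "group (torsion_part G)"
      by (simp add: torsion_part_def G)
    have "\<not> torsion_part G \<cong> (direct_sum :: (int \<Rightarrow> 'n mod_ring) monoid)"
      by (rule not_iso_if_annihilated[where s = s, OF tgroup _ single_one_direct_sum(1,2) n(1)])
         (simp_all only: single_one_direct_sum(3) of_nat_single_one_iff n full_order tpow tone ann
           not_False_eq_True)
    moreover have "\<not> G \<cong> restricted_wreath (additive_group :: 'n mod_ring monoid) integer_group"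
    proof (rule not_iso_if_annihilated[OF group _ single_one_wreath(1,2) n(1)])
      show "y [^]\<^bsub>G\<^esub> s = \<one>\<^bsub>G\<^esub>" if "y \<in> carrier G" "has_finite_order G y" for y
        using ann[of y] that by (simp add: torsion_part_def pow) (simp add: G)
    qed (simp_all only: single_one_wreath(3) of_nat_single_one_iff n full_order prod.inject
           not_False_eq_True simp_thms)
    moreover have "\<exists>s. 0 < s \<and> s < int n \<and> annihilated_by (torsion_part G) s"
      using annihilated s(1,2) by (intro exI[of _ "int s"]) simp
    ultimately show ?thesis
      using False generated by blast
  qed
qed

end
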